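(* Let $G$ be a connected weighted graph whose vertex set is a disjoint union $B\cup C\cup S\cup T$, where the vertices in $B$ have no neighbours in $S\cup T$ and the vertices in $C$ have no neighbours in $T$. Let $\widetilde H$ be the subgraph of $G$ induced by $B\cup C$, and, keeping the original degrees in $G$ for the vertices of $\widetilde H$, let $$M(\widetilde H)=\begin{bmatrix} M[B,B] & M[B,C]\\ M[C,B] & M[C,C]\end{bmatrix}$$ be the principal submatrix of $M(G)$ indexed by $B\cup C$. Let $U_{\widetilde H}(t)=\exp(itM(\widetilde H))$ and $U_G(t)=\exp(itM(G))$. If $\mathbf{x}\in\mathbb{R}^{|B|+|C|}$ satisfies $$\begin{bmatrix}\mathbf{0} & M[S,C]\end{bmatrix}M(\widetilde H)^{j}\,\mathbf{x}=\mathbf{0}\quad\text{for all } j\ge 0,$$ then for all $t\in\mathbb{R}$, $$U_G(t)\begin{bmatrix}\mathbf{x}\\ \mathbf{0}\end{bmatrix}=\begin{bmatrix}U_{\widetilde H}(t)\mathbf{x}\\ \mathbf{0}\end{bmatrix}.$$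
   Context: A weighted graph has positive edge weights $w$; its adjacency matrix $A$ has $A_{ij}=w(i,j)$ if $ij$ is an edge and $0$ otherwise, $\Delta$ is the diagonal matrix of row sums of $A$, $L=\Delta-A$, $Q=\Delta+A$. $M(G)$ denotes any one of $A$, $L$, $Q$ (the same choice throughout). $M[X,Y]$ is the submatrix of $M(G)$ with rows indexed by $X$ and columns by $Y$. Vertices are ordered as $B,C,S,T$, so that $$M(G)=\begin{bmatrix} M[B,B]&M[B,C]&\mathbf{0}&\mathbf{0}\\ M[C,B]&M[C,C]&M[C,S]&\mathbf{0}\\ \mathbf{0}&M[S,C]&M[S,S]&M[S,T]\\ \mathbf{0}&\mathbf{0}&M[T,S]&M[T,T]\end{bmatrix}.$$ *)

theory Defs
  imports
    Complex_Main
    "Graph_Theory.Digraph_Component"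
    "Jordan_Normal_Form.Matrix"
begin

text \<open>
  An undirected graph is a symmetric digraph. Loops are not excluded; a loop at a vertex
  contributes its weight once to the row sum. The values of \<open>w\<close> off the edge set are
  irrelevant.
\<close>

locale weighted_graph = pair_pseudo_graph G for G :: "'v pair_pre_digraph" +
  fixes w :: "'v \<Rightarrow> 'v \<Rightarrow> real"
  assumes weight_pos: "(u, v) \<in> parcs G \<Longrightarrow> w u v > 0"
    and weight_sym: "(u, v) \<in> parcs G \<Longrightarrow> w u v = w v u"

datatype matrix_kind = Adjacency | Laplacian | Signless_Laplacian

definition adj_entry :: "'v pair_pre_digraph \<Rightarrow> ('v \<Rightarrow> 'v \<Rightarrow> real) \<Rightarrow> 'v \<Rightarrow> 'v \<Rightarrow> real" where
  "adj_entry G w u v = (if (u, v) \<in> parcs G then w u v else 0)"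

definition deg_entry :: "'v pair_pre_digraph \<Rightarrow> ('v \<Rightarrow> 'v \<Rightarrow> real) \<Rightarrow> 'v \<Rightarrow> 'v \<Rightarrow> real" where
  "deg_entry G w u v = (if u = v then \<Sum>x\<in>pverts G. adj_entry G w u x else 0)"

fun graph_entry ::
  "matrix_kind \<Rightarrow> 'v pair_pre_digraph \<Rightarrow> ('v \<Rightarrow> 'v \<Rightarrow> real) \<Rightarrow> 'v \<Rightarrow> 'v \<Rightarrow> real" where
  "graph_entry Adjacency G w u v = adj_entry G w u v"
| "graph_entry Laplacian G w u v = deg_entry G w u v - adj_entry G w u v"
| "graph_entry Signless_Laplacian G w u v = deg_entry G w u v + adj_entry G w u v"

text \<open>
  The block \<open>M[X,Y]\<close>. The vertex sets are given as lists without repetitions, which fix the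
  order of the rows and columns; \<open>M(G)\<close> itself is \<open>M[V,V]\<close> for a list \<open>V\<close> of all vertices.
  Degrees are always taken in \<open>G\<close>.
\<close>

definition graph_block ::
  "matrix_kind \<Rightarrow> 'v pair_pre_digraph \<Rightarrow> ('v \<Rightarrow> 'v \<Rightarrow> real) \<Rightarrow> 'v list \<Rightarrow> 'v list \<Rightarrow> real mat" where
  "graph_block k G w X Y =
     mat (length X) (length Y) (\<lambda>(i, j). graph_entry k G w (X ! i) (Y ! j))"

definition append_cols :: "'a :: zero mat \<Rightarrow> 'a mat \<Rightarrow> 'a mat" (infixr \<open>@\<^sub>c\<close> 65) where
  "A @\<^sub>c B = four_block_mat A B (0\<^sub>m 0 (dim_col A)) (0\<^sub>m 0 (dim_col B))"

text \<open>
  The exponential of a square matrix, as the entrywise sum of the power series, which converges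
  by \<open>mat_exp_sums\<close>.
\<close>

definition mat_exp :: "complex mat \<Rightarrow> complex mat" where
  "mat_exp A = mat (dim_row A) (dim_row A) (\<lambda>(i, j). \<Sum>k. (A ^\<^sub>m k) $$ (i, j) / fact k)"

lemma pow_mat_entry_bound:
  fixes A :: "complex mat"
  assumes A: "A \<in> carrier_mat n n"
    and c: "\<And>i j. i < n \<Longrightarrow> j < n \<Longrightarrow> norm (A $$ (i, j)) \<le> c"
  shows "i < n \<Longrightarrow> j < n \<Longrightarrow> norm ((A ^\<^sub>m k) $$ (i, j)) \<le> (real n * c) ^ k"
proof (induction k arbitrary: i j)
  case 0
  then show ?case using A by simp
next
  case (Suc k)
  have P: "A ^\<^sub>m k \<in> carrier_mat n n" using A by simp
  have "(A ^\<^sub>m Suc k) $$ (i, j) = (\<Sum>l<n. (A ^\<^sub>m k) $$ (i, l) * A $$ (l, j))"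
    using A P Suc.prems by (simp add: scalar_prod_def lessThan_atLeast0)
  also have "norm \<dots> \<le> (\<Sum>l<n. (real n * c) ^ k * c)"
    using Suc by (intro sum_norm_le) (auto simp: norm_mult intro!: mult_mono' c)
  also have "\<dots> = (real n * c) ^ Suc k" by simp
  finally show ?case .
qed

lemma mat_exp_sums:
  assumes A: "A \<in> carrier_mat n n" and "i < n" "j < n"
  shows "(\<lambda>k. (A ^\<^sub>m k) $$ (i, j) / fact k) sums (mat_exp A $$ (i, j))"
proof -
  define c where "c = (\<Sum>p\<in>{..<n} \<times> {..<n}. norm (A $$ p))"
  have c: "norm (A $$ (i, j)) \<le> c" if "i < n" "j < n" for i j
    unfolding c_def by (rule member_le_sum) (use that in auto)
  have "summable (\<lambda>k. (A ^\<^sub>m k) $$ (i, j) / fact k)"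
  proof (rule summable_comparison_test)
    show "summable (\<lambda>k. inverse (fact k) * (real n * c) ^ k)" by (rule summable_exp)
    show "\<exists>N. \<forall>k\<ge>N. norm ((A ^\<^sub>m k) $$ (i, j) / fact k) \<le> inverse (fact k) * (real n * c) ^ k"
      using pow_mat_entry_bound[OF A c assms(2,3)]
      by (auto simp: norm_divide divide_simps)
  qed
  then show ?thesis using assms by (simp add: mat_exp_def summable_sums)
qed

text \<open>The transition matrix \<open>exp(itM)\<close> of a continuous quantum walk.\<close>

definition transition_mat :: "real mat \<Rightarrow> real \<Rightarrow> complex mat" where
  "transition_mat M t = mat_exp ((\<i> * complex_of_real t) \<cdot>\<^sub>m map_mat complex_of_real M)"

end

theory Submission
  imports Defs
begin

text \<open>
  The hypothesis says that the blocks of \<open>M(G)\<close> below \<open>M(H)\<close> annihilate the Krylov space of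
  \<open>M(H)\<close> generated by \<open>x\<close>. So the zero extension of \<open>x\<close> stays a zero extension
  under every power of \<open>M(G)\<close>, and the claim follows by summing the exponential series.
\<close>

text \<open>Each multiplication sends \<open>(x, 0)\<close> to \<open>(A x, C x)\<close>, since
  \<open>B\<close> and \<open>D\<close> act only on the zero part, and \<open>C x = 0\<close>. The
  induction peels off the rightmost factor and continues with \<open>A x\<close> in place of
  \<open>x\<close>, so \<open>x\<close> is generalised. The hypothesis passes on to
  \<open>A x\<close> because it covers all exponents \<open>j\<close>.\<close>

lemma four_block_mat_pow_mult_vec:
  fixes A :: "'a :: comm_ring_1 mat"
  assumes A: "A \<in> carrier_mat n n" and B: "B \<in> carrier_mat n m"
    and C: "C \<in> carrier_mat m n" and D: "D \<in> carrier_mat m m"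
    and x: "x \<in> carrier_vec n"
    and C0: "\<And>j. C *\<^sub>v (A ^\<^sub>m j *\<^sub>v x) = 0\<^sub>v m"
  shows "four_block_mat A B C D ^\<^sub>m k *\<^sub>v (x @\<^sub>v 0\<^sub>v m) = (A ^\<^sub>m k *\<^sub>v x) @\<^sub>v 0\<^sub>v m"
  using x C0
proof (induction k arbitrary: x)
  case 0
  then show ?case using A D by simp
next
  case (Suc k)
  let ?F = "four_block_mat A B C D"
  have F: "?F \<in> carrier_mat (n + m) (n + m)" using A D by simp
  have x: "x \<in> carrier_vec n" using Suc.prems by simp
  have Ax: "A *\<^sub>v x \<in> carrier_vec n" using A x by simp
  \<comment> \<open>Index shift: the hypothesis for \<open>A x\<close> at \<open>j\<close> is the
    one for \<open>x\<close> at \<open>Suc j\<close>.\<close>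
  have pow: "A ^\<^sub>m j *\<^sub>v (A *\<^sub>v x) = A ^\<^sub>m Suc j *\<^sub>v x" for j
    using A x by (simp add: assoc_mult_mat_vec[of _ n n])
  have "C *\<^sub>v x = 0\<^sub>v m" using Suc.prems(2)[of 0] A x by simp
  then have "?F *\<^sub>v (x @\<^sub>v 0\<^sub>v m) = (A *\<^sub>v x) @\<^sub>v 0\<^sub>v m"
    using A B D x by (subst four_block_mat_mult_vec[OF A B C D x]) (auto intro!: eq_vecI simp: scalar_prod_def)
  then have "?F ^\<^sub>m Suc k *\<^sub>v (x @\<^sub>v 0\<^sub>v m) = ?F ^\<^sub>m k *\<^sub>v ((A *\<^sub>v x) @\<^sub>v 0\<^sub>v m)"
    using F x by (simp add: assoc_mult_mat_vec[of _ "n + m" "n + m"])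
  also have "\<dots> = (A ^\<^sub>m k *\<^sub>v (A *\<^sub>v x)) @\<^sub>v 0\<^sub>v m"
    by (rule Suc.IH[OF Ax]) (use Suc.prems(2) in \<open>simp only: pow\<close>)
  finally show ?case by (simp only: pow)
qed

text \<open>An entry of the product is a finite linear combination of entries of
  \<open>mat_exp A\<close>, so their convergent series may be added termwise.\<close>

lemma mat_exp_mult_vec_sums:
  assumes A: "A \<in> carrier_mat n n" and v: "v \<in> carrier_vec n" and i: "i < n"
  shows "(\<lambda>k. (A ^\<^sub>m k *\<^sub>v v) $ i / fact k) sums ((mat_exp A *\<^sub>v v) $ i)"
proof -
  have E: "mat_exp A \<in> carrier_mat n n" using A by (simp add: mat_exp_def)
  have "(\<lambda>k. \<Sum>j<n. (A ^\<^sub>m k) $$ (i, j) / fact k * v $ j) sums (\<Sum>j<n. mat_exp A $$ (i, j) * v $ j)"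
    by (intro sums_sum sums_mult2 mat_exp_sums[OF A i]) simp
  then show ?thesis
    using A E v i
    by (simp add: scalar_prod_def lessThan_atLeast0 sum_divide_distrib)
qed

lemma smult_mat_pow:
  fixes A :: "'a :: comm_ring_1 mat"
  assumes A: "A \<in> carrier_mat n n"
  shows "(c \<cdot>\<^sub>m A) ^\<^sub>m k = c ^ k \<cdot>\<^sub>m A ^\<^sub>m k"
proof (induction k)
  case 0
  then show ?case using A by (intro eq_matI) auto
next
  case (Suc k)
  have P: "A ^\<^sub>m k \<in> carrier_mat n n" using A by simp
  then have "(c \<cdot>\<^sub>m A) ^\<^sub>m Suc k = c ^ k \<cdot>\<^sub>m (A ^\<^sub>m k * (c \<cdot>\<^sub>m A))"
    using Suc A by (simp add: mult_smult_assoc_mat[of _ n n _ n])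
  also have "\<dots> = c ^ k \<cdot>\<^sub>m (c \<cdot>\<^sub>m (A ^\<^sub>m k * A))"
    using mult_smult_distrib[OF P A] by simp
  also have "\<dots> = c ^ Suc k \<cdot>\<^sub>m A ^\<^sub>m Suc k"
    using P A by (intro eq_matI) (auto simp: ac_simps)
  finally show ?case .
qed

text \<open>The scalar comes out of the power, and \<open>complex_of_real\<close>, being a ring
  homomorphism, comes out of the matrix products. What remains are real vectors
  \<open>M ^\<^sub>m k *\<^sub>v v\<close>, to which the real block computation applies.\<close>

lemma transition_mat_mult_vec_sums:
  assumes M: "M \<in> carrier_mat n n" and v: "v \<in> carrier_vec n" and i: "i < n"
  shows "(\<lambda>k. (\<i> * complex_of_real t) ^ k * complex_of_real ((M ^\<^sub>m k *\<^sub>v v) $ i) / fact k) sums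
    ((transition_mat M t *\<^sub>v map_vec complex_of_real v) $ i)"
proof -
  let ?M = "map_mat complex_of_real M" and ?v = "map_vec complex_of_real v"
  let ?c = "\<i> * complex_of_real t"
  have M': "?M \<in> carrier_mat n n" using M by simp
  have "((?c \<cdot>\<^sub>m ?M) ^\<^sub>m k *\<^sub>v ?v) $ i = ?c ^ k * complex_of_real ((M ^\<^sub>m k *\<^sub>v v) $ i)" for k
  proof -
    have P: "M ^\<^sub>m k \<in> carrier_mat n n" using M by simp
    have "((?c \<cdot>\<^sub>m ?M) ^\<^sub>m k *\<^sub>v ?v) = ?c ^ k \<cdot>\<^sub>v (?M ^\<^sub>m k *\<^sub>v ?v)"
      using M' v by (subst smult_mat_pow[OF M']) (auto intro!: eq_vecI)
    also have "?M ^\<^sub>m k *\<^sub>v ?v = map_vec complex_of_real (M ^\<^sub>m k *\<^sub>v v)"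
      by (simp add: of_real_hom.mat_hom_pow[OF M] of_real_hom.mult_mat_vec_hom[OF P v])
    finally show ?thesis using M P i by simp
  qed
  then show ?thesis
    using mat_exp_mult_vec_sums[of "?c \<cdot>\<^sub>m ?M" n ?v i] M v i
    by (simp add: transition_mat_def)
qed

lemma graph_block_carrier [simp]:
  "graph_block k G w X Y \<in> carrier_mat (length X) (length Y)"
  by (simp add: graph_block_def)

lemma graph_block_append:
  "graph_block k G w (X @ X') (Y @ Y') =
    four_block_mat (graph_block k G w X Y) (graph_block k G w X Y')
      (graph_block k G w X' Y) (graph_block k G w X' Y')"
  by (intro eq_matI) (auto simp: graph_block_def nth_append)

text \<open>Disjointness removes the degree terms, which sit only at \<open>u = v\<close>; the
  absence of arcs removes the adjacency terms. This covers all three kinds of matrix.\<close>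

lemma graph_block_eq_zero:
  assumes "set X \<inter> set Y = {}" and "\<And>u v. u \<in> set X \<Longrightarrow> v \<in> set Y \<Longrightarrow> (u, v) \<notin> parcs G"
  shows "graph_block k G w X Y = 0\<^sub>m (length X) (length Y)"
proof -
  have "graph_entry k G w u v = 0" if "u \<in> set X" "v \<in> set Y" for u v
    using assms that by (cases k) (auto simp: adj_entry_def deg_entry_def)
  then show ?thesis by (intro eq_matI) (auto simp: graph_block_def)
qed

text \<open>Bridges the annihilation hypothesis of the theorem, which concerns only the rows in
  \<open>S\<close>, and the full lower left block with rows in \<open>S\<close> and
  \<open>T\<close>, whose \<open>T\<close> rows are zero.\<close>

lemma four_block_zero_rows_mult_vec:
  fixes A :: "'a :: comm_ring_1 mat"
  assumes A: "A \<in> carrier_mat s b" and C: "C \<in> carrier_mat s c"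
    and y: "y \<in> carrier_vec (b + c)"
    and 0: "(A @\<^sub>c C) *\<^sub>v y = 0\<^sub>v s"
  shows "four_block_mat A C (0\<^sub>m t b) (0\<^sub>m t c) *\<^sub>v y = 0\<^sub>v (s + t)"
proof -
  obtain a d where y_eq: "y = a @\<^sub>v d" and a: "a \<in> carrier_vec b" and d: "d \<in> carrier_vec c"
    using y vec_first_last_append[OF y] vec_first_carrier vec_last_carrier by metis
  have zero: "0\<^sub>m r b *\<^sub>v a + 0\<^sub>m r c *\<^sub>v d = (0\<^sub>v r :: 'a vec)" for r
    using a d by (intro eq_vecI) auto
  \<comment> \<open>The number \<open>r\<close> of zero rows is left free: \<open>r = 0\<close> is
    the case of \<open>append_cols\<close>, hence of the hypothesis, and \<open>r = t\<close> is the
    case of the conclusion.\<close>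
  have mult: "four_block_mat A C (0\<^sub>m r b) (0\<^sub>m r c) *\<^sub>v y = (A *\<^sub>v a + C *\<^sub>v d) @\<^sub>v 0\<^sub>v r" for r
    unfolding y_eq zero[symmetric]
    by (rule four_block_mat_mult_vec[OF A C _ _ a d]) auto
  have "(A *\<^sub>v a + C *\<^sub>v d) @\<^sub>v 0\<^sub>v 0 = 0\<^sub>v s"
    using 0 mult[of 0] A C by (simp add: append_cols_def)
  moreover have "v @\<^sub>v 0\<^sub>v 0 = v" for v :: "'a vec" by (intro eq_vecI) auto
  ultimately have "A *\<^sub>v a + C *\<^sub>v d = 0\<^sub>v s" by simp
  then show ?thesis using mult by auto
qed

theorem lemma1:
  fixes G :: "'v pair_pre_digraph" and w :: "'v \<Rightarrow> 'v \<Rightarrow> real"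
    and B C S T :: "'v list" and kind :: matrix_kind and x :: "real vec"
  defines "M \<equiv> graph_block kind G w"
  defines "MG \<equiv> M (B @ C @ S @ T) (B @ C @ S @ T)"
  defines "MH \<equiv> four_block_mat (M B B) (M B C) (M C B) (M C C)"
  assumes "weighted_graph G w"
    and "Digraph_Component.connected (with_proj G)"
    and "pverts G = set B \<union> set C \<union> set S \<union> set T"
    and "distinct (B @ C @ S @ T)"
    and "\<forall>u\<in>set B. \<forall>v\<in>set S \<union> set T. (u, v) \<notin> parcs G"
    and "\<forall>u\<in>set C. \<forall>v\<in>set T. (u, v) \<notin> parcs G"
    and "x \<in> carrier_vec (length B + length C)"
    and "\<forall>j. (0\<^sub>m (length S) (length B) @\<^sub>c M S C) *\<^sub>v (MH ^\<^sub>m j *\<^sub>v x) = 0\<^sub>v (length S)"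
  shows "\<forall>t::real.
    transition_mat MG t *\<^sub>v map_vec complex_of_real (x @\<^sub>v 0\<^sub>v (length S + length T)) =
    (transition_mat MH t *\<^sub>v map_vec complex_of_real x) @\<^sub>v 0\<^sub>v (length S + length T)"
proof
  fix t :: real
  define n where "n = length B + length C"
  define m where "m = length S + length T"
  define R where "R = M (B @ C) (S @ T)"
  define K where "K = M (S @ T) (B @ C)"
  define D where "D = M (S @ T) (S @ T)"
  interpret weighted_graph G w by fact
  have sym: "(u, v) \<in> parcs G \<Longrightarrow> (v, u) \<in> parcs G" for u v
    by (rule arcs_symmetric)
  \<comment> \<open>The four vertex classes are regrouped into two, \<open>B @ C\<close> and
    \<open>S @ T\<close>, so that \<open>MG\<close> becomes a 2 by 2 block matrix with
    \<open>MH\<close> in its upper left corner.\<close>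
  have MH_eq: "MH = M (B @ C) (B @ C)"
    by (simp add: MH_def M_def graph_block_append)
  have MG_eq: "MG = four_block_mat MH R K D"
    unfolding MG_def MH_eq R_def K_def D_def M_def
    using graph_block_append[of kind G w "B @ C" "S @ T" "B @ C" "S @ T"] by simp
  have carr: "MH \<in> carrier_mat n n" "R \<in> carrier_mat n m" "K \<in> carrier_mat m n" "D \<in> carrier_mat m m"
    unfolding MH_eq R_def K_def D_def M_def n_def m_def
    by (auto intro: carrier_matI simp: graph_block_def)
  have MG: "MG \<in> carrier_mat (n + m) (n + m)" using carr by (simp add: MG_eq)
  have x: "x \<in> carrier_vec n" using assms by (simp add: n_def)
  \<comment> \<open>The assumptions exclude arcs from \<open>B\<close> and \<open>C\<close>
    outwards; these blocks need the reverse direction, which \<open>sym\<close> supplies.\<close>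
  have zero: "M S B = 0\<^sub>m (length S) (length B)" "M T B = 0\<^sub>m (length T) (length B)"
    "M T C = 0\<^sub>m (length T) (length C)"
    unfolding M_def using assms(7-9) by (auto intro!: graph_block_eq_zero dest: sym)
  have K_eq: "K = four_block_mat (0\<^sub>m (length S) (length B)) (M S C)
      (0\<^sub>m (length T) (length B)) (0\<^sub>m (length T) (length C))"
    using graph_block_append[of kind G w S T B C] zero by (simp add: K_def M_def)
  have K0: "K *\<^sub>v (MH ^\<^sub>m j *\<^sub>v x) = 0\<^sub>v m" for j
    unfolding K_eq m_def
  proof (rule four_block_zero_rows_mult_vec)
    have "MH ^\<^sub>m j \<in> carrier_mat n n" using carr by simp
    then show "MH ^\<^sub>m j *\<^sub>v x \<in> carrier_vec (length B + length C)"
      using x unfolding n_def by (rule mult_mat_vec_carrier)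
  qed (use assms(11) in \<open>auto simp: M_def\<close>)
  have pow: "MG ^\<^sub>m k *\<^sub>v (x @\<^sub>v 0\<^sub>v m) = (MH ^\<^sub>m k *\<^sub>v x) @\<^sub>v 0\<^sub>v m" for k
    unfolding MG_eq by (rule four_block_mat_pow_mult_vec[OF carr x K0])
  have x0: "x @\<^sub>v 0\<^sub>v m \<in> carrier_vec (n + m)" using x by simp
  have dim_H: "dim_vec (MH ^\<^sub>m k *\<^sub>v x) = n" for k
    using carr(1) by simp
  have dim_UH: "dim_vec (transition_mat MH t *\<^sub>v map_vec complex_of_real x) = n"
    and dim_UG: "dim_row (transition_mat MG t) = n + m"
    using carr MG by (auto simp: transition_mat_def mat_exp_def)
  show "transition_mat MG t *\<^sub>v map_vec complex_of_real (x @\<^sub>v 0\<^sub>v (length S + length T)) =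
    (transition_mat MH t *\<^sub>v map_vec complex_of_real x) @\<^sub>v 0\<^sub>v (length S + length T)"
    unfolding m_def[symmetric]
  proof (rule eq_vecI)
    fix i assume "i < dim_vec ((transition_mat MH t *\<^sub>v map_vec complex_of_real x) @\<^sub>v 0\<^sub>v m)"
    then have i: "i < n + m" using dim_UH by simp
    let ?L = "(transition_mat MG t *\<^sub>v map_vec complex_of_real (x @\<^sub>v 0\<^sub>v m)) $ i"
    \<comment> \<open>The common series: by \<open>pow\<close> it is the exponential series for
      entry \<open>i\<close> of the left side, and it is shown below to sum to entry
      \<open>i\<close> of the right side as well. Uniqueness of sums then gives equality.\<close>
    let ?a = "\<lambda>k. (\<i> * complex_of_real t) ^ k *
      complex_of_real (((MH ^\<^sub>m k *\<^sub>v x) @\<^sub>v 0\<^sub>v m) $ i) / fact k"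
    have L: "?a sums ?L"
      using transition_mat_mult_vec_sums[OF MG x0 i] by (simp only: pow)
    have "?a sums (((transition_mat MH t *\<^sub>v map_vec complex_of_real x) @\<^sub>v 0\<^sub>v m) $ i)"
    proof (cases "i < n")
      case True
      then show ?thesis
        using transition_mat_mult_vec_sums[OF carr(1) x True] dim_H dim_UH i
        by (simp add: index_append_vec del: index_mult_mat_vec)
    next
      \<comment> \<open>For \<open>i\<close> at least \<open>n\<close> every term lies in the zero
        padding, so the series sums to 0, which is also the padded entry on the right.\<close>
      case False
      then show ?thesis using dim_H dim_UH i
        by (simp add: index_append_vec del: index_mult_mat_vec dim_mult_mat_vec)
    qed
    with L show "?L = ((transition_mat MH t *\<^sub>v map_vec complex_of_real x) @\<^sub>v 0\<^sub>v m) $ i"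
      by (rule sums_unique2)
  qed (use dim_UH dim_UG in simp)
qed

end
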